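(* There is a universal constant $C(2)>0$ (independent of $u$, $R$ and $\Theta$) such that the following holds. Let $R>0$, let $\Theta\in\mathbb{R}$ be a constant, and let $u$ be a smooth solution on $B_R(0)\subset\mathbb{R}^2$ of the special Lagrangian equation $$\arctan\lambda_1+\arctan\lambda_2=\Theta,$$ where $\lambda_1,\lambda_2$ are the eigenvalues of the Hessian $D^2u$. Then both of the following estimates hold: $$|D^2u(0)|\le C(2)\exp\left[C(2)\max_{B_R(0)}|Du|^2/R^2\right]$$ and $$|D^2u(0)|\le C(2)\exp\left[C(2)\frac{1}{|\sin\Theta|^{3/2}}\max_{B_R(0)}|Du|/R\right],$$ where the second estimate is understood to be vacuous (right-hand side $+\infty$) when $\sin\Theta=0$.
   Context: $B_r(x)$ denotes the open Euclidean ball (disc) of radius $r$ centred at $x$ in $\mathbb{R}^2$. $Du$ and $D^2u$ are the Euclidean gradient and Hessian; $|Du|$ is the Euclidean norm and $|D^2u|$ the operator norm of the Hessian, i.e. the maximum of $|\lambda_1|,|\lambda_2|$ (another fixed matrix norm only changes the constant). $\arctan$ takes values in $(-\pi/2,\pi/2)$, so the phase $\Theta$ necessarily lies in $(-\pi,\pi)$. $\max_{B_R(0)}$ is understood as a supremum (an estimate whose right-hand side is infinite is vacuous). *)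

theory Defs
  imports "HOL-Analysis.Analysis"
begin

text \<open>
  Derivatives are taken with respect to the full filter \<open>at x\<close>, so on an open set \<open>S\<close> all notions
  below depend only on the restriction of the function to \<open>S\<close>.
\<close>

primrec Ck_on :: "nat \<Rightarrow> 'a::real_normed_vector set \<Rightarrow> ('a \<Rightarrow> 'b::real_normed_vector) \<Rightarrow> bool" where
  "Ck_on 0 S f \<longleftrightarrow> continuous_on S f"
| "Ck_on (Suc k) S f \<longleftrightarrow>
     (\<forall>x\<in>S. f differentiable (at x)) \<and>
     (\<forall>v. Ck_on k S (\<lambda>x. frechet_derivative f (at x) v))"

definition smooth_on :: "'a::real_normed_vector set \<Rightarrow> ('a \<Rightarrow> 'b::real_normed_vector) \<Rightarrow> bool" where
  "smooth_on S f \<longleftrightarrow> (\<forall>k. Ck_on k S f)"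

definition grad :: "(real ^ 'n \<Rightarrow> real) \<Rightarrow> real ^ 'n \<Rightarrow> real ^ 'n" where
  "grad u x = (\<chi> i. frechet_derivative u (at x) (axis i 1))"

definition hessian :: "(real ^ 'n \<Rightarrow> real) \<Rightarrow> real ^ 'n \<Rightarrow> real ^ 'n ^ 'n" where
  "hessian u x = jacobian (grad u) (at x)"

definition op_norm :: "real ^ 'n ^ 'm \<Rightarrow> real" where
  "op_norm A = onorm (\<lambda>v. A *v v)"

text \<open>
  \<open>l1, l2\<close> are the eigenvalues of \<open>A\<close> counted with algebraic multiplicity, i.e. the roots of the
  characteristic polynomial; a double eigenvalue appears as \<open>l1 = l2\<close>.
\<close>

definition eigenvalues2 :: "real ^ 2 ^ 2 \<Rightarrow> real \<Rightarrow> real \<Rightarrow> bool" where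
  "eigenvalues2 A l1 l2 \<longleftrightarrow> (\<forall>t. det (mat t - A) = (t - l1) * (t - l2))"

lemma eigenvalues2_iff_eigenvector:
  assumes "eigenvalues2 A l1 l2"
  shows "c \<in> {l1, l2} \<longleftrightarrow> (\<exists>v. v \<noteq> 0 \<and> A *v v = c *s v)"
proof -
  have m: "(mat c - A) *v v = c *s v - A *v v" for v :: "real ^ 2"
    by (simp add: vec_eq_iff forall_2 matrix_vector_mult_def mat_def sum_2 algebra_simps)
  have "c \<in> {l1, l2} \<longleftrightarrow> det (mat c - A) = 0"
    using assms by (auto simp: eigenvalues2_def)
  also have "\<dots> \<longleftrightarrow> \<not> invertible (mat c - A)"
    by (simp add: invertible_det_nz)
  also have "\<dots> \<longleftrightarrow> \<not> (\<forall>v. (mat c - A) *v v = 0 \<longrightarrow> v = 0)"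
    by (metis invertible_left_inverse matrix_left_invertible_ker)
  finally show ?thesis by (auto simp: m)
qed

lemma eigenvalues2_symmetric_exists:
  assumes "transpose A = A"
  obtains l1 l2 where "eigenvalues2 A l1 l2"
proof -
  define h e b where "h = (A $ 1 $ 1 + A $ 2 $ 2) / 2" "e = (A $ 1 $ 1 - A $ 2 $ 2) / 2" "b = A $ 1 $ 2"
  have entries: "A $ 1 $ 1 = h + e" "A $ 2 $ 2 = h - e" "A $ 1 $ 2 = b"
    by (simp_all add: h_e_b_def field_simps)
  have sym: "A $ 2 $ 1 = b"
  proof -
    have "A $ 2 $ 1 = transpose A $ 1 $ 2"
      by (simp add: transpose_def)
    then show ?thesis
      by (simp only: assms entries)
  qed
  define s where "s = sqrt (e * e + b * b)"
  have s2: "s * s = e * e + b * b" by (simp add: s_def)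
  have "det (mat t - A) = (t - (h + s)) * (t - (h - s))" for t
  proof -
    have "det (mat t - A) = (t - (h + e)) * (t - (h - e)) - b * b"
      by (simp add: det_2 mat_def entries sym)
    also have "\<dots> = (t - h) * (t - h) - (e * e + b * b)"
      by (simp add: algebra_simps)
    also have "\<dots> = (t - (h + s)) * (t - (h - s))"
      unfolding s2[symmetric] by (simp add: algebra_simps)
    finally show ?thesis .
  qed
  then show ?thesis using that by (auto simp: eigenvalues2_def)
qed

definition special_lagrangian_on :: "(real ^ 2) set \<Rightarrow> real \<Rightarrow> (real ^ 2 \<Rightarrow> real) \<Rightarrow> bool" where
  "special_lagrangian_on S \<Theta> u \<longleftrightarrow>
     (\<forall>x\<in>S. \<exists>l1 l2. eigenvalues2 (hessian u x) l1 l2 \<and> arctan l1 + arctan l2 = \<Theta>)"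

end

theory Submission
  imports Defs "HOL-Complex_Analysis.Conformal_Mappings"
begin

text \<open>
  In two dimensions the gradient graph of a special Lagrangian potential is a holomorphic curve.
  Suppose the phase \<open>\<Theta>\<close> lies in \<open>[0, pi)\<close> (otherwise replace \<open>u\<close> by \<open>- u\<close>) and put \<open>c = cos (\<Theta>/2)\<close>,
  \<open>s = sin (\<Theta>/2)\<close>. The Lewy rotation \<open>F x = c x + s Du x\<close> multiplies distances by at least \<open>1 / (2 c)\<close>
  (\<open>lewy_rotation_lower\<close>), so it is injective and images of discs contain discs of comparable radius
  (\<open>expanding_image_contains_ball\<close>). In the new coordinate \<open>F x\<close> the equation says that the rotated
  potential is harmonic, that is, the conjugate of \<open>c Du - s x\<close> is a holomorphic function \<open>f\<close>. The
  larger eigenvalue of the Hessian at the centre is \<open>(s + c |f'|) / (c - s |f'|)\<close>.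

  The numerator is controlled by Cauchy's estimate. The denominator equals \<open>c \<epsilon>\<close> with
  \<open>\<epsilon> = 1 - (s/c) |f'|\<close>; here \<open>1/c\<close> is bounded by a multiple of \<open>1 + sup |Du| / R\<close> because of the
  expansion property, and a lower bound on \<open>\<epsilon>\<close> comes from a chain of Harnack inequalities
  (\<open>degeneracy_lower_bound\<close>): if \<open>\<epsilon>\<close> is tiny, then \<open>f'\<close> stays nearly constant along a
  segment of many steps, along which the original point \<open>x\<close> barely moves but \<open>Du\<close> grows linearly.
  Together this gives \<open>|D\<^sup>2u(0)| \<le> 120 exp (34 sup |Du| / R)\<close> uniformly in the phase
  (\<open>hessian_bound_linear_exponent\<close>), from which both stated estimates follow.
\<close>

section \<open>Harnack chains for holomorphic functions\<close>

text \<open>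
  Harnack's inequality in the form used below: the Cayley transform turns \<open>p\<close> into a self-map of the
  disc vanishing at the centre, to which the Schwarz lemma applies.
\<close>

lemma Harnack_half_disc:
  assumes hol: "p holomorphic_on ball z0 r"
    and pos: "\<And>z. z \<in> ball z0 r \<Longrightarrow> Re (p z) > 0"
    and z: "cmod (z - z0) \<le> r / 2" and r: "r > 0"
  shows "cmod (p z) \<le> 3 * cmod (p z0)"
proof -
  define a where "a = p z0"
  have a: "Re a > 0" using pos[of z0] r by (simp add: a_def)
  define \<phi> where "\<phi> w = (p (z0 + of_real r * w) - a) / (p (z0 + of_real r * w) + cnj a)" for w
  have in_ball: "z0 + of_real r * w \<in> ball z0 r" if "cmod w < 1" for w
    using that r by (simp add: dist_norm norm_mult)
  have nz: "p (z0 + of_real r * w) + cnj a \<noteq> 0" if "cmod w < 1" for w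
  proof
    assume "p (z0 + of_real r * w) + cnj a = 0"
    then have "Re (p (z0 + of_real r * w)) + Re a = 0" by (simp add: complex_eq_iff)
    with pos[OF in_ball[OF that]] a show False by simp
  qed
  have hol': "(\<lambda>w. p (z0 + of_real r * w)) holomorphic_on ball 0 1"
    by (rule holomorphic_on_compose_gen[of "\<lambda>w. z0 + of_real r * w" _ p "ball z0 r", unfolded o_def])
      (use hol in_ball in \<open>auto intro!: holomorphic_intros\<close>)
  have "\<phi> holomorphic_on ball 0 1"
    unfolding \<phi>_def by (intro holomorphic_intros hol') (use nz in auto)
  moreover have "\<phi> 0 = 0" by (simp add: \<phi>_def a_def)
  moreover have "cmod (\<phi> w) < 1" if "cmod w < 1" for w
  proof -
    let ?q = "p (z0 + of_real r * w)"
    have "(cmod (?q - a))\<^sup>2 < (cmod (?q + cnj a))\<^sup>2"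
      using mult_pos_pos[OF pos[OF in_ball[OF that]] a]
      unfolding cmod_power2 by (simp add: power2_eq_square algebra_simps)
    then have "cmod (?q - a) < cmod (?q + cnj a)"
      by (rule power_less_imp_less_base) simp
    then show ?thesis by (simp add: \<phi>_def norm_divide divide_less_eq)
  qed
  moreover define w where "w = (z - z0) / of_real r"
  have w: "cmod w \<le> 1/2" using z r by (simp add: w_def norm_divide divide_le_eq)
  ultimately have \<phi>: "cmod (\<phi> w) \<le> 1/2"
    using Schwarz_Lemma(1)[of \<phi> w] by force
  have "z0 + of_real r * w = z" using r by (simp add: w_def)
  then have eq: "\<phi> w * (p z + cnj a) = p z - a"
    using nz[of w] w by (simp add: \<phi>_def)
  have "cmod (p z) \<le> cmod a + cmod (p z - a)" by norm
  also have "cmod (p z - a) \<le> 1/2 * cmod (p z + cnj a)"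
    unfolding eq[symmetric] norm_mult by (intro mult_right_mono \<phi>) simp
  also have "cmod (p z + cnj a) \<le> cmod (p z) + cmod a"
    using norm_triangle_ineq[of "p z" "cnj a"] by simp
  finally show ?thesis by (simp add: a_def field_simps)
qed

lemma three_power_le_exp: "(3::real) ^ n \<le> exp (2 * real n)"
proof -
  have "(3::real) \<le> exp 2" using exp_ge_add_one_self[of 2] by simp
  then have "(3::real) ^ n \<le> exp 2 ^ n" by (intro power_mono) auto
  then show ?thesis by (simp add: exp_of_nat_mult[symmetric] mult.commute)
qed

text \<open>
  The quantitative heart of the argument. On the rotated domain \<open>\<Omega>\<close> the original position \<open>X\<close> and the
  original gradient \<open>P\<close> are expressed through a single holomorphic function \<open>f\<close>, and the map \<open>X\<close>
  degenerates as \<open>s |f'| / c\<close> tends to 1. If \<open>\<epsilon> = 1 - s |f' z0| / c\<close> is small, let \<open>\<omega>\<close> be the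
  direction of \<open>f' z0\<close>. Then \<open>p = 1 - (s / c) cnj \<omega> f'\<close> has positive real part and \<open>p z0 = \<epsilon>\<close>, so by
  Harnack \<open>|p|\<close> at most triples with each step of length \<open>\<delta>\<close>. Steps are taken in the direction \<open>v\<close> with
  \<open>v\<^sup>2 = cnj \<omega>\<close>, the nearly degenerate direction of \<open>X\<close>: as long as \<open>p\<close> is small, \<open>X\<close> hardly moves, so
  that the chain stays in the domain, while \<open>P\<close> advances by at least \<open>R / (16 s c)\<close> per step. Since \<open>P\<close>
  is bounded by \<open>m\<close>, at most about \<open>32 s c m / R\<close> steps are possible, and hence \<open>\<epsilon>\<close> cannot be smaller
  than an exponential in \<open>- m / R\<close>.
\<close>

lemma degeneracy_lower_bound:
  fixes f :: "complex \<Rightarrow> complex" and c s R m :: real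
  defines "X \<equiv> \<lambda>z. of_real c * z - of_real s * cnj (f z)"
    and "P \<equiv> \<lambda>z. of_real s * z + of_real c * cnj (f z)"
  assumes "open \<Omega>" and hol: "f holomorphic_on \<Omega>"
    and c: "c > 0" and s: "s > 0" and cs: "c\<^sup>2 + s\<^sup>2 = 1" and R: "R > 0"
    and bound: "\<And>z. z \<in> \<Omega> \<Longrightarrow> s * cmod (deriv f z) < c"
    and room: "\<And>z. z \<in> \<Omega> \<Longrightarrow> cmod (X z) \<le> R / 2 \<Longrightarrow> ball z (R / (4 * c)) \<subseteq> \<Omega>"
    and z0: "z0 \<in> \<Omega>" "X z0 = 0"
    and m: "\<And>z. z \<in> \<Omega> \<Longrightarrow> cmod (P z) \<le> m"
  shows "exp (- (32 * m / R)) / 6 \<le> 1 - s / c * cmod (deriv f z0)"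
proof (rule ccontr)
  define \<epsilon> where "\<epsilon> = 1 - s / c * cmod (deriv f z0)"
  assume "\<not> ?thesis"
  then have small: "\<epsilon> < exp (- (32 * m / R)) / 6" by (simp add: \<epsilon>_def)
  define \<omega> where "\<omega> = (if deriv f z0 = 0 then 1 else sgn (deriv f z0))"
  have \<omega>: "cmod \<omega> = 1" by (simp add: \<omega>_def norm_sgn)
  then have \<omega>\<omega>: "\<omega> * cnj \<omega> = 1" by (simp add: complex_norm_square[symmetric])
  define v where "v = csqrt (cnj \<omega>)"
  have v: "cmod v = 1" and v2: "v * v = cnj \<omega>"
    using \<omega> power2_csqrt[of "cnj \<omega>"] by (simp_all add: v_def power2_eq_square)
  have vv: "v * cnj v = 1" using v by (simp add: complex_norm_square[symmetric])
  have \<omega>v: "cnj \<omega> * cnj v = v"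
    by (metis v2 vv mult.assoc mult.right_neutral)
  define p where "p z = 1 - of_real (s / c) * cnj \<omega> * deriv f z" for z
  have derf: "(f has_field_derivative deriv f z) (at z)" if "z \<in> \<Omega>" for z
    using hol \<open>open \<Omega>\<close> that by (simp add: holomorphic_derivI)
  have f': "deriv f z = of_real (c / s) * \<omega> * (1 - p z)" for z
    using c s \<omega>\<omega> by (simp add: p_def field_simps)
  have holp: "p holomorphic_on \<Omega>"
    unfolding p_def by (intro holomorphic_intros holomorphic_deriv hol \<open>open \<Omega>\<close>)
  have posp: "Re (p z) > 0" if "z \<in> \<Omega>" for z
  proof -
    have "Re (of_real (s / c) * cnj \<omega> * deriv f z) \<le> cmod (of_real (s / c) * cnj \<omega> * deriv f z)"
      by (rule complex_Re_le_cmod)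
    also have "\<dots> = s / c * cmod (deriv f z)"
      using c s \<omega> by (simp add: norm_mult norm_divide)
    also have "\<dots> < 1" using bound[OF that] c by (simp add: divide_less_eq)
    finally show ?thesis by (simp add: p_def)
  qed
  have "cnj (sgn w) * w = of_real (cmod w)" if "w \<noteq> 0" for w :: complex
    using that complex_norm_square[of w]
    by (simp add: sgn_div_norm scaleR_conv_of_real divide_simps power2_eq_square mult.commute)
  then have "cnj \<omega> * deriv f z0 = of_real (cmod (deriv f z0))"
    by (simp add: \<omega>_def)
  then have "p z0 = of_real \<epsilon>"
    by (simp add: p_def \<epsilon>_def mult.assoc)
  moreover have "\<epsilon> > 0" using bound[OF z0(1)] c by (simp add: \<epsilon>_def divide_less_eq)
  ultimately have p0: "cmod (p z0) = \<epsilon>" and \<epsilon>: "\<epsilon> > 0" by auto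
  define \<delta> where "\<delta> = R / (8 * c)"
  have \<delta>: "\<delta> > 0" using R c by (simp add: \<delta>_def)
  \<comment> \<open>The step length is half the radius \<open>R / (4 * c)\<close> available by \<open>room\<close>, as Harnack requires.\<close>
  have step: "z + of_real \<delta> * v \<in> \<Omega> \<and> cmod (p (z + of_real \<delta> * v)) \<le> 3 * e
      \<and> cmod (X (z + of_real \<delta> * v) - X z) \<le> 3 * R / 8 * e
      \<and> R / (16 * (s * c)) \<le> Re (cnj v * (P (z + of_real \<delta> * v) - P z))"
    if z: "z \<in> \<Omega>" "cmod (X z) \<le> R / 2" "cmod (p z) \<le> e" "e \<le> 1 / 6" for z e
  proof -
    let ?z = "z + of_real \<delta> * v"
    have sub: "ball z (R / (4 * c)) \<subseteq> \<Omega>" by (rule room) fact+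
    have cb: "cball z \<delta> \<subseteq> ball z (R / (4 * c))"
      using R c by (auto simp: \<delta>_def field_simps)
    have z': "?z \<in> cball z \<delta>" using \<delta> v by (simp add: dist_norm norm_mult)
    have harnack: "cmod (p y) \<le> 3 * e" if "y \<in> cball z \<delta>" for y
    proof -
      have "cmod (p y) \<le> 3 * cmod (p z)"
      proof (rule Harnack_half_disc[of p z "R / (4 * c)"])
        show "p holomorphic_on ball z (R / (4 * c))"
          using holp sub by (rule holomorphic_on_subset)
        show "cmod (y - z) \<le> R / (4 * c) / 2"
          using that by (simp add: \<delta>_def dist_norm norm_minus_commute)
      qed (use posp sub R c in auto)
      with z(3) show ?thesis by simp
    qed
    \<comment> \<open>The error \<open>E\<close> of replacing \<open>f\<close> by the affine map of slope \<open>(c / s) \<omega>\<close>; for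
      that affine map, \<open>X\<close> would be constant along \<open>v\<close>.\<close>
    define E where "E = (f ?z - of_real (c / s) * \<omega> * ?z) - (f z - of_real (c / s) * \<omega> * z)"
    have "cmod E \<le> (c / s * (3 * e)) * cmod (?z - z)"
      unfolding E_def
    proof (rule field_differentiable_bound[of "cball z \<delta>"])
      fix y assume y: "y \<in> cball z \<delta>"
      then have "y \<in> \<Omega>" using sub cb by blast
      show "((\<lambda>z. f z - of_real (c / s) * \<omega> * z) has_field_derivative
          deriv f y - of_real (c / s) * \<omega>) (at y within cball z \<delta>)"
        by (rule has_field_derivative_at_within, intro DERIV_diff derf DERIV_cmult_Id \<open>y \<in> \<Omega>\<close>)
      have "deriv f y - of_real (c / s) * \<omega> = - (of_real (c / s) * \<omega> * p y)"
        by (simp add: f'[of y] right_diff_distrib del: of_real_divide)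
      then have "cmod (deriv f y - of_real (c / s) * \<omega>) = c / s * cmod (p y)"
        using c s \<omega> by (simp add: norm_mult norm_divide)
      also have "\<dots> \<le> c / s * (3 * e)"
        using c s by (intro mult_left_mono harnack y) auto
      finally show "cmod (deriv f y - of_real (c / s) * \<omega>) \<le> c / s * (3 * e)" .
    qed (use z' \<delta> in auto)
    then have E: "cmod E \<le> c / s * (3 * e) * \<delta>"
      using \<delta> v by (simp add: norm_mult)
    have fdiff: "f ?z - f z = of_real (c / s) * \<omega> * of_real \<delta> * v + E"
      by (simp add: E_def algebra_simps del: of_real_divide)
    have cfdiff: "cnj (f ?z) - cnj (f z) = of_real (c / s) * of_real \<delta> * v + cnj E"
    proof -
      have "cnj (f ?z) - cnj (f z) = cnj (f ?z - f z)" by simp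
      also have "\<dots> = of_real (c / s) * of_real \<delta> * (cnj \<omega> * cnj v) + cnj E"
        unfolding fdiff by (simp add: algebra_simps del: of_real_divide)
      finally show ?thesis by (simp only: \<omega>v)
    qed
    have "X ?z - X z = of_real c * of_real \<delta> * v - of_real s * (cnj (f ?z) - cnj (f z))"
      by (simp add: X_def algebra_simps)
    also have "\<dots> = - (of_real s * cnj E)"
      unfolding cfdiff using less_imp_neq[OF s] by (simp add: field_simps)
    finally have "cmod (X ?z - X z) = s * cmod E" using s by (simp add: norm_mult)
    also have "\<dots> \<le> s * (c / s * (3 * e) * \<delta>)" using s E by (intro mult_left_mono) auto
    also have "\<dots> = 3 * R / 8 * e" using s c by (simp add: \<delta>_def)
    finally have Xd: "cmod (X ?z - X z) \<le> 3 * R / 8 * e" .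
    have "P ?z - P z = of_real s * of_real \<delta> * v + of_real c * (cnj (f ?z) - cnj (f z))"
      by (simp add: P_def algebra_simps)
    also have "\<dots> = of_real (s * \<delta> + c * (c / s) * \<delta>) * v + of_real c * cnj E"
      unfolding cfdiff by (simp only: of_real_add of_real_mult distrib_left distrib_right mult.assoc add.assoc)
    also have "s * \<delta> + c * (c / s) * \<delta> = \<delta> * (c\<^sup>2 + s\<^sup>2) / s"
      using s by (simp add: field_simps power2_eq_square)
    also have "\<dots> = \<delta> / s" by (simp add: cs)
    finally have "cnj v * (P ?z - P z) = of_real (\<delta> / s) * (v * cnj v) + of_real c * (cnj v * cnj E)"
      by (simp add: algebra_simps)
    then have Pd: "Re (cnj v * (P ?z - P z)) = \<delta> / s + c * Re (cnj v * cnj E)"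
      unfolding vv by simp
    have "\<bar>Re (cnj v * cnj E)\<bar> \<le> cmod E"
      using abs_Re_le_cmod[of "cnj v * cnj E"] v by (simp add: norm_mult)
    then have "c * Re (cnj v * cnj E) \<ge> c * (- (c / s * (3 * e) * \<delta>))"
      using c E by (intro mult_left_mono) auto
    moreover have "c * (c / s * (3 * e) * \<delta>) \<le> \<delta> / s * (1 / 2)"
    proof -
      have e0: "0 \<le> e" using z(3) norm_ge_zero[of "p z"] by linarith
      have "c\<^sup>2 * (3 * e) \<le> 1 * (1 / 2)"
        using cs z(4) e0 zero_le_power2[of s] by (intro mult_mono) linarith+
      then have "\<delta> / s * (c\<^sup>2 * (3 * e)) \<le> \<delta> / s * (1 * (1 / 2))"
        using \<delta> s by (intro mult_left_mono) auto
      then show ?thesis by (simp add: power2_eq_square field_simps)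
    qed
    ultimately have "\<delta> / s * (1 / 2) \<le> Re (cnj v * (P ?z - P z))" unfolding Pd by linarith
    moreover have "\<delta> / s * (1 / 2) = R / (16 * (s * c))" by (simp add: \<delta>_def field_simps)
    ultimately show ?thesis using harnack[OF z'] Xd z' sub cb by auto
  qed
  \<comment> \<open>In the bound on \<open>X\<close>, the constant \<open>1/4\<close> reproduces itself since \<open>1/4 + 3/8 \<le> 3 * (1/4)\<close>.\<close>
  define \<zeta> where "\<zeta> k = z0 + of_real (real k * \<delta>) * v" for k :: nat
  have chain: "\<zeta> k \<in> \<Omega> \<and> cmod (p (\<zeta> k)) \<le> 3 ^ k * \<epsilon> \<and> cmod (X (\<zeta> k)) \<le> R / 4 * (3 ^ k * \<epsilon>)
      \<and> real k * (R / (16 * (s * c))) \<le> Re (cnj v * (P (\<zeta> k) - P z0))"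
    if "3 ^ k * \<epsilon> \<le> 1 / 2" for k
    using that
  proof (induction k)
    case 0
    then show ?case using z0 p0 R \<epsilon> by (simp add: \<zeta>_def)
  next
    case (Suc k)
    define e where "e = 3 ^ k * \<epsilon>"
    have e: "0 < e" "e \<le> 1 / 6" using Suc.prems \<epsilon> by (auto simp: e_def)
    then have IH: "\<zeta> k \<in> \<Omega>" "cmod (p (\<zeta> k)) \<le> e" "cmod (X (\<zeta> k)) \<le> R / 4 * e"
      "real k * (R / (16 * (s * c))) \<le> Re (cnj v * (P (\<zeta> k) - P z0))"
      using Suc.IH by (auto simp: e_def)
    have "R / 4 * e \<le> R / 4 * (1 / 6)" using e R by (intro mult_left_mono) auto
    then have "cmod (X (\<zeta> k)) \<le> R / 2" using IH(3) R by linarith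
    note st = step[OF IH(1) this IH(2) e(2)]
    have \<zeta>S: "\<zeta> (Suc k) = \<zeta> k + of_real \<delta> * v" by (simp add: \<zeta>_def algebra_simps)
    have "cmod (X (\<zeta> (Suc k))) \<le> cmod (X (\<zeta> k)) + cmod (X (\<zeta> (Suc k)) - X (\<zeta> k))" by norm
    also have "\<dots> \<le> R / 4 * e + 3 * R / 8 * e"
      using IH(3) st unfolding \<zeta>S by (intro add_mono) auto
    also have "\<dots> \<le> R / 4 * (3 * e)" using R e by (simp add: field_simps)
    finally have "cmod (X (\<zeta> (Suc k))) \<le> R / 4 * (3 * e)" .
    moreover have "real (Suc k) * (R / (16 * (s * c))) \<le> Re (cnj v * (P (\<zeta> (Suc k)) - P z0))"
    proof -
      have "cnj v * (P (\<zeta> (Suc k)) - P z0)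
          = cnj v * (P (\<zeta> (Suc k)) - P (\<zeta> k)) + cnj v * (P (\<zeta> k) - P z0)"
        by (simp add: algebra_simps)
      moreover have "R / (16 * (s * c)) \<le> Re (cnj v * (P (\<zeta> (Suc k)) - P (\<zeta> k)))"
        using st unfolding \<zeta>S by simp
      ultimately have "Re (cnj v * (P (\<zeta> (Suc k)) - P z0))
          \<ge> R / (16 * (s * c)) + real k * (R / (16 * (s * c)))"
        using IH(4) by (simp only: plus_complex.sel)
      moreover have "real (Suc k) * (R / (16 * (s * c)))
          = R / (16 * (s * c)) + real k * (R / (16 * (s * c)))"
        by (simp only: of_nat_Suc distrib_right mult_1_left)
      ultimately show ?thesis by (simp only:)
    qed
    ultimately show ?case using st unfolding \<zeta>S by (simp add: e_def)
  qed
  have m0: "m \<ge> 0" using m[OF z0(1)] norm_ge_zero[of "P z0"] by linarith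
  \<comment> \<open>Taking \<open>Suc n\<close> steps contradicts the bound on \<open>P\<close>, because \<open>2 * s * c \<le> 1\<close>.\<close>
  define n where "n = nat \<lfloor>16 * m / R\<rfloor>"
  have n: "real n \<le> 16 * m / R" "16 * m / R < real (Suc n)"
    using m0 R unfolding n_def by (simp_all add: of_nat_floor, linarith)
  have "3 ^ n * \<epsilon> \<le> exp (2 * real n) * \<epsilon>"
    using \<epsilon> three_power_le_exp by (intro mult_right_mono) auto
  also have "\<dots> \<le> exp (32 * m / R) * \<epsilon>"
    using n \<epsilon> by (intro mult_right_mono) auto
  also have "\<dots> \<le> exp (32 * m / R) * (exp (- (32 * m / R)) / 6)"
    using small by (intro mult_left_mono) auto
  also have "\<dots> = 1 / 6" by (simp add: exp_minus)
  finally have "3 ^ Suc n * \<epsilon> \<le> 1 / 2" by simp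
  from chain[OF this] have "\<zeta> (Suc n) \<in> \<Omega>"
    "real (Suc n) * (R / (16 * (s * c))) \<le> Re (cnj v * (P (\<zeta> (Suc n)) - P z0))" by auto
  note this(2)
  also have "Re (cnj v * (P (\<zeta> (Suc n)) - P z0)) \<le> cmod (P (\<zeta> (Suc n)) - P z0)"
    using complex_Re_le_cmod[of "cnj v * (P (\<zeta> (Suc n)) - P z0)"] v by (simp add: norm_mult)
  also have "\<dots> \<le> cmod (P (\<zeta> (Suc n))) + cmod (P z0)" by norm
  also have "\<dots> \<le> 2 * m" using m[OF \<open>\<zeta> (Suc n) \<in> \<Omega>\<close>] m[OF z0(1)] by simp
  finally have "real (Suc n) * R \<le> 2 * m * (16 * (s * c))"
    using s c by (simp add: field_simps)
  also have "\<dots> = 16 * m * (2 * (s * c))" by simp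
  also have "\<dots> \<le> 16 * m * 1"
    using m0 cs sum_squares_bound[of s c] by (intro mult_left_mono) auto
  finally show False using n(2) R by (simp add: field_simps)
qed

section \<open>Expanding maps\<close>

lemma expanding_if_derivative_coercive:
  fixes F :: "'a::real_inner \<Rightarrow> 'a"
  assumes "convex S" and a: "a \<in> S" and b: "b \<in> S"
    and der: "\<And>x. x \<in> S \<Longrightarrow> (F has_derivative F' x) (at x)"
    and coercive: "\<And>x w. x \<in> S \<Longrightarrow> \<kappa> * (norm w)\<^sup>2 \<le> F' x w \<bullet> w"
  shows "\<kappa> * norm (a - b) \<le> norm (F a - F b)"
proof (cases "a = b")
  case False
  define w where "w = a - b"
  have seg: "b + t *\<^sub>R w \<in> S" if "0 \<le> t" "t \<le> 1" for t
    using convexD[OF \<open>convex S\<close> b a, of "1 - t" t] that by (simp add: w_def algebra_simps)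
  have "((\<lambda>t. F (b + t *\<^sub>R w) \<bullet> w) has_real_derivative F' (b + t *\<^sub>R w) w \<bullet> w) (at t)"
    if "0 \<le> t" "t \<le> 1" for t
  proof -
    interpret F': bounded_linear "F' (b + t *\<^sub>R w)"
      using der[OF seg[OF that]] by (rule has_derivative_bounded_linear)
    have "((\<lambda>t. b + t *\<^sub>R w) has_derivative (\<lambda>h. h *\<^sub>R w)) (at t)"
      by (auto intro!: derivative_eq_intros)
    from has_derivative_compose[OF this der[OF seg[OF that]]]
    have "((\<lambda>t. F (b + t *\<^sub>R w) \<bullet> w) has_derivative (\<lambda>h. F' (b + t *\<^sub>R w) (h *\<^sub>R w) \<bullet> w)) (at t)"
      by (rule has_derivative_inner_left)
    then show ?thesis
      by (rule has_derivative_imp_has_field_derivative) (simp add: F'.scaleR)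
  qed
  then obtain t where t: "0 < t" "t < 1"
    and eq: "F (b + 1 *\<^sub>R w) \<bullet> w - F (b + 0 *\<^sub>R w) \<bullet> w = (1 - 0) * (F' (b + t *\<^sub>R w) w \<bullet> w)"
    using MVT2[of 0 1 "\<lambda>t. F (b + t *\<^sub>R w) \<bullet> w" "\<lambda>t. F' (b + t *\<^sub>R w) w \<bullet> w"] by auto
  have "\<kappa> * norm w * norm w \<le> F' (b + t *\<^sub>R w) w \<bullet> w"
    using coercive[OF seg, of t w] t by (simp add: power2_eq_square algebra_simps)
  also have "\<dots> = (F a - F b) \<bullet> w" using eq by (simp add: w_def inner_diff_left)
  also have "\<dots> \<le> norm (F a - F b) * norm w" by (rule norm_cauchy_schwarz)
  finally show ?thesis using False by (simp add: w_def)
qed simp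

text \<open>
  The image is open by invariance of domain, and its trace on the target ball is relatively closed
  because expansion confines preimages of a smaller closed ball to a compact set.
\<close>

lemma expanding_image_contains_ball:
  fixes F :: "'a::euclidean_space \<Rightarrow> 'a"
  assumes cont: "continuous_on (ball y d) F" and \<kappa>: "\<kappa> > 0" and d: "d > 0"
    and expand: "\<And>a b. a \<in> ball y d \<Longrightarrow> b \<in> ball y d \<Longrightarrow> \<kappa> * norm (a - b) \<le> norm (F a - F b)"
  shows "ball (F y) (\<kappa> * d) \<subseteq> F ` ball y d"
proof -
  let ?B = "ball (F y) (\<kappa> * d)"
  have inj: "inj_on F (ball y d)"
  proof (rule inj_onI)
    fix a b assume "a \<in> ball y d" "b \<in> ball y d" "F a = F b"
    then have "\<kappa> * norm (a - b) \<le> 0" using expand[of a b] by simp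
    then show "a = b" using \<kappa> by (simp add: mult_le_0_iff)
  qed
  have "open (F ` ball y d)"
    by (rule invariance_of_domain[OF cont open_ball inj])
  then have "openin (top_of_set ?B) (?B \<inter> F ` ball y d)"
    by (simp add: openin_open_Int)
  moreover have "closedin (top_of_set ?B) (?B \<inter> F ` ball y d)"
  proof (rule closedin_limpt[THEN iffD2], intro conjI allI impI)
    fix w assume w: "w islimpt ?B \<inter> F ` ball y d \<and> w \<in> ?B"
    define d' where "d' = (dist (F y) w / \<kappa> + d) / 2"
    have d': "dist (F y) w < \<kappa> * d'" "d' < d"
      using w \<kappa> by (auto simp: d'_def field_simps)
    have "w \<in> closure (F ` cball y d')"
      unfolding closure_approachable
    proof (intro allI impI)
      fix e :: real assume e: "e > 0"
      define e' where "e' = min e (\<kappa> * d' - dist (F y) w)"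
      have "e' > 0" using e d' by (simp add: e'_def)
      then obtain a where a: "a \<in> ball y d" "dist (F a) w < e'"
        using w unfolding islimpt_approachable by blast
      have "\<kappa> * norm (y - a) \<le> dist (F y) (F a)"
        using expand[of y a] a d by (simp add: dist_norm)
      also have "\<dots> \<le> dist (F y) w + dist (F a) w"
        by (metis dist_commute dist_triangle)
      also have "\<dots> \<le> \<kappa> * d'" using a(2) by (simp add: e'_def)
      finally have "a \<in> cball y d'" using \<kappa> by (simp add: dist_norm)
      then show "\<exists>z\<in>F ` cball y d'. dist z w < e" using a(2) by (auto simp: e'_def)
    qed
    moreover have "cball y d' \<subseteq> ball y d" using d' by auto
    then have "compact (F ` cball y d')"
      by (intro compact_continuous_image continuous_on_subset[OF cont]) auto
    then have "closed (F ` cball y d')" by (rule compact_imp_closed)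
    ultimately have "w \<in> F ` cball y d'" by (simp add: closure_closed)
    then show "w \<in> ?B \<inter> F ` ball y d" using w \<open>cball y d' \<subseteq> ball y d\<close> by auto
  qed auto
  moreover have "F y \<in> ?B \<inter> F ` ball y d" using \<kappa> d by simp
  moreover have "connected ?B" by simp
  ultimately show ?thesis
    unfolding connected_clopen by blast
qed

section \<open>Lewy rotation and the Hessian bound in complex form\<close>

lemma arctan_phase_eq:
  assumes "arctan a + arctan b = \<Theta>"
  shows "cos \<Theta> * (a + b) = sin \<Theta> * (1 - a * b)"
proof -
  have t: "sin (arctan t) = t * cos (arctan t)" for t
    using tan_arctan[of t] cos_arctan_not_zero[of t] by (simp add: tan_def field_simps)
  show ?thesis
    unfolding assms[symmetric] cos_add sin_add t by (simp add: algebra_simps)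
qed

text \<open>
  After rotation by half the phase, the stretching factor \<open>c + s a\<close> is bounded below. Multiplied
  by \<open>2 c cos (arctan a)\<close> and rearranged, the claim says that \<open>cos (\<Theta> - arctan a) = cos (arctan b)\<close> is nonnegative.
\<close>

lemma lewy_rotation_lower:
  assumes "arctan a + arctan b = \<Theta>" and "0 \<le> \<Theta>" "\<Theta> < pi"
  shows "1 / (2 * cos (\<Theta> / 2)) \<le> cos (\<Theta> / 2) + sin (\<Theta> / 2) * a"
proof -
  let ?c = "cos (\<Theta> / 2)" and ?s = "sin (\<Theta> / 2)"
  have c: "?c > 0" using assms by (intro cos_gt_zero_pi) auto
  have "cos \<Theta> * cos (arctan a) + sin \<Theta> * sin (arctan a) = cos (arctan b)"
    unfolding cos_diff[symmetric] assms(1)[symmetric] by simp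
  moreover have "sin (arctan a) = a * cos (arctan a)"
    using tan_arctan[of a] cos_arctan_not_zero[of a] by (simp add: tan_def field_simps)
  ultimately have "(cos \<Theta> + sin \<Theta> * a) * cos (arctan a) = cos (arctan b)"
    by (simp add: algebra_simps)
  moreover have "cos (arctan t) > 0" for t
    using arctan_bounded[of t] by (intro cos_gt_zero_pi) auto
  ultimately have "cos \<Theta> + sin \<Theta> * a > 0"
    by (metis zero_less_mult_pos2)
  moreover have "cos \<Theta> = 2 * ?c\<^sup>2 - 1" "sin \<Theta> = 2 * ?s * ?c"
    using cos_double_cos[of "\<Theta> / 2"] sin_double[of "\<Theta> / 2"] by simp_all
  ultimately have "1 \<le> 2 * ?c * (?c + ?s * a)"
    by (simp add: algebra_simps power2_eq_square)
  then show ?thesis using c by (simp add: field_simps)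
qed

text \<open>
  The special Lagrangian equation for eigenvalues \<open>\<tau> + b\<close> and \<open>\<tau> - b\<close>, rewritten in the half-angle
  functions \<open>c\<close> and \<open>s\<close>. It makes the rotated gradient map holomorphic up to conjugation.
\<close>

lemma lewy_conformal_identity:
  fixes \<tau> b c s :: real
  assumes "(c\<^sup>2 - s\<^sup>2) * (2 * \<tau>) = 2 * s * c * (1 - (\<tau>\<^sup>2 - b\<^sup>2))" and "c\<^sup>2 + s\<^sup>2 = 1"
  shows "s * c * b\<^sup>2 = (c * \<tau> - s) * (c + s * \<tau>)"
proof -
  have "2 * (s * c * b\<^sup>2) = 2 * ((c * \<tau> - s) * (c + s * \<tau>))"
    using assms(1) by (simp add: algebra_simps power2_eq_square)
  then show ?thesis by simp
qed

text \<open>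
  The estimate for a nonnegative phase, with the plane identified with the complex numbers. A
  symmetric derivative of the gradient \<open>P\<close> acts as \<open>v \<mapsto> \<tau> v + \<beta> cnj v\<close> with \<open>\<tau>\<close> real, and its
  eigenvalues are \<open>\<tau> + |\<beta>|\<close> and \<open>\<tau> - |\<beta>|\<close>. The map \<open>F = c x + s P\<close> is the new position after the
  rotation, \<open>W = cnj (c P - s x)\<close> the conjugate of the new gradient, and \<open>f = W \<circ> G\<close>, with \<open>G\<close> the inverse
  of \<open>F\<close>, is holomorphic.
\<close>

lemma hessian_bound_complex:
  fixes P :: "complex \<Rightarrow> complex" and \<tau> :: "complex \<Rightarrow> real" and \<beta> :: "complex \<Rightarrow> complex"
  assumes R: "R > 0" and \<Theta>: "0 \<le> \<Theta>" "\<Theta> < pi"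
    and der: "\<And>x. x \<in> ball 0 R \<Longrightarrow>
      (P has_derivative (\<lambda>v. of_real (\<tau> x) * v + \<beta> x * cnj v)) (at x)"
    and phase: "\<And>x. x \<in> ball 0 R \<Longrightarrow>
      arctan (\<tau> x + cmod (\<beta> x)) + arctan (\<tau> x - cmod (\<beta> x)) = \<Theta>"
    and m: "\<And>x. x \<in> ball 0 R \<Longrightarrow> cmod (P x) \<le> m"
  shows "\<bar>\<tau> 0\<bar> + cmod (\<beta> 0) \<le> 120 * exp (34 * m / R)"
proof -
  define c where "c = cos (\<Theta> / 2)"
  define s where "s = sin (\<Theta> / 2)"
  have c: "c > 0" using \<Theta> by (auto simp: c_def intro!: cos_gt_zero_pi)
  have s: "s \<ge> 0" using \<Theta> by (auto simp: s_def intro!: sin_ge_zero)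
  have cs: "c\<^sup>2 + s\<^sup>2 = 1" by (simp add: c_def s_def)
  have c1: "c \<le> 1" and s1: "s \<le> 1" by (simp_all add: c_def s_def)
  define A where "A x = c + s * \<tau> x" for x
  define F where "F x = of_real c * x + of_real s * P x" for x
  define W where "W x = cnj (of_real c * P x - of_real s * x)" for x
  have lower: "1 / (2 * c) \<le> A x - s * cmod (\<beta> x)" if "x \<in> ball 0 R" for x
    using lewy_rotation_lower[OF _ \<Theta>, of "\<tau> x - cmod (\<beta> x)" "\<tau> x + cmod (\<beta> x)"] phase[OF that]
    by (simp add: A_def c_def s_def algebra_simps)
  have c2: "1 / (2 * c) > 0" using c by simp
  have Apos: "A x > 0" if "x \<in> ball 0 R" for x
  proof -
    have "s * cmod (\<beta> x) \<ge> 0" using s by simp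
    with lower[OF that] c2 show ?thesis by linarith
  qed
  have conf: "s * c * (cmod (\<beta> x))\<^sup>2 = (c * \<tau> x - s) * A x" if "x \<in> ball 0 R" for x
    unfolding A_def
  proof (rule lewy_conformal_identity[OF _ cs])
    have "cos \<Theta> = c\<^sup>2 - s\<^sup>2" "sin \<Theta> = 2 * s * c"
      using cos_double[of "\<Theta> / 2"] sin_double[of "\<Theta> / 2"] by (simp_all add: c_def s_def)
    then show "(c\<^sup>2 - s\<^sup>2) * (2 * \<tau> x) = 2 * s * c * (1 - ((\<tau> x)\<^sup>2 - (cmod (\<beta> x))\<^sup>2))"
      using arctan_phase_eq[OF phase[OF that]] by (simp add: power2_eq_square square_diff_square_factored)
  qed
  have derF: "(F has_derivative (\<lambda>v. of_real (A x) * v + of_real s * \<beta> x * cnj v)) (at x)"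
    if "x \<in> ball 0 R" for x
    unfolding F_def
    by (rule derivative_eq_intros der[OF that] refl)+ (simp add: A_def algebra_simps)
  have derW: "(W has_derivative
      (\<lambda>v. of_real c * cnj (\<beta> x) * v + of_real (c * \<tau> x - s) * cnj v)) (at x)"
    if "x \<in> ball 0 R" for x
    unfolding W_def
    by (rule derivative_eq_intros der[OF that] refl)+ (simp add: algebra_simps)
  have expand: "1 / (2 * c) * cmod (x - y) \<le> cmod (F x - F y)"
    if "x \<in> ball 0 R" "y \<in> ball 0 R" for x y
  proof (rule expanding_if_derivative_coercive[OF convex_ball that derF])
    fix x w :: complex assume x: "x \<in> ball 0 R"
    have "\<bar>(\<beta> x * cnj w) \<bullet> w\<bar> \<le> cmod (\<beta> x) * (cmod w)\<^sup>2"
      using Cauchy_Schwarz_ineq2[of "\<beta> x * cnj w" w]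
      by (simp add: norm_mult power2_eq_square mult.assoc)
    then have "s * (- (cmod (\<beta> x) * (cmod w)\<^sup>2)) \<le> s * ((\<beta> x * cnj w) \<bullet> w)"
      using s by (intro mult_left_mono) auto
    moreover have "1 / (2 * c) * (cmod w)\<^sup>2 \<le> (A x - s * cmod (\<beta> x)) * (cmod w)\<^sup>2"
      using lower[OF x] by (rule mult_right_mono) simp
    moreover have "(of_real (A x) * w + of_real s * \<beta> x * cnj w) \<bullet> w
        = A x * (cmod w)\<^sup>2 + s * ((\<beta> x * cnj w) \<bullet> w)"
      unfolding inner_complex_def cmod_power2 by (simp add: algebra_simps power2_eq_square)
    ultimately show "1 / (2 * c) * (cmod w)\<^sup>2
        \<le> (of_real (A x) * w + of_real s * \<beta> x * cnj w) \<bullet> w"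
      by (simp add: algebra_simps)
  qed
  define \<Omega> where "\<Omega> = F ` ball 0 R"
  have contF: "continuous_on (ball 0 R) F"
    using derF by (meson continuous_at_imp_continuous_on has_derivative_continuous)
  have inj: "inj_on F (ball 0 R)"
  proof (rule inj_onI)
    fix x y assume "x \<in> ball 0 R" "y \<in> ball 0 R" "F x = F y"
    with expand[of x y] c show "x = y" by (simp add: field_simps)
  qed
  have open\<Omega>: "open \<Omega>"
    unfolding \<Omega>_def by (rule invariance_of_domain[OF contF open_ball inj])
  define G where "G = inv_into (ball 0 R) F"
  have GF: "G (F x) = x" if "x \<in> ball 0 R" for x
    using that inj by (simp add: G_def)
  have contG: "continuous_on \<Omega> G"
  proof (rule lipschitz_on_continuous_on[of "2 * c"], rule lipschitz_onI)
    fix u v assume "u \<in> \<Omega>" "v \<in> \<Omega>"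
    then show "dist (G u) (G v) \<le> 2 * c * dist u v"
      using expand c by (auto simp: \<Omega>_def GF dist_norm field_simps)
  qed (use c in simp)
  define f where "f u = W (G u)" for u
  define w where "w x = of_real c * cnj (\<beta> x) / of_real (A x)" for x
  have derf: "(f has_field_derivative w x) (at (F x))" if x: "x \<in> ball 0 R" for x
  proof -
    define D where "D = (A x)\<^sup>2 - (s * cmod (\<beta> x))\<^sup>2"
    have "D = (A x - s * cmod (\<beta> x)) * (A x + s * cmod (\<beta> x))"
      by (simp add: D_def algebra_simps power2_eq_square)
    moreover have "A x - s * cmod (\<beta> x) > 0" using lower[OF x] c2 by linarith
    moreover have "A x + s * cmod (\<beta> x) > 0" using s Apos[OF x] by (intro add_pos_nonneg) auto
    ultimately have D: "D > 0" by simp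
    \<comment> \<open>The inverse of the derivative of \<open>F\<close>, whose real determinant is \<open>D\<close>.\<close>
    define G' where "G' u = (of_real (A x) * u - of_real s * \<beta> x * cnj u) / of_real D" for u
    have bb: "\<beta> x * cnj (\<beta> x) = of_real ((cmod (\<beta> x))\<^sup>2)"
      by (rule complex_norm_square[symmetric])
    have D': "of_real D = of_real (A x) * of_real (A x) - of_real s * of_real s * (\<beta> x * cnj (\<beta> x))"
      unfolding bb D_def by (simp add: power2_eq_square)
    have DA: "of_real D \<noteq> (0::complex)" "of_real (A x) \<noteq> (0::complex)" using D Apos[OF x] by auto
    have linG': "bounded_linear G'"
      unfolding G'_def
      by (intro bounded_linear_intros bounded_linear_divide[THEN bounded_linear_compose]
          bounded_linear_sub bounded_linear_mult_right[THEN bounded_linear_compose] bounded_linear_cnj)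
    have "G' (of_real (A x) * v + of_real s * \<beta> x * cnj v) = v" for v
    proof -
      have "of_real (A x) * (of_real (A x) * v + of_real s * \<beta> x * cnj v)
          - of_real s * \<beta> x * cnj (of_real (A x) * v + of_real s * \<beta> x * cnj v) = of_real D * v"
        unfolding D' by (simp add: algebra_simps)
      then show ?thesis unfolding G'_def using DA by simp
    qed
    then have left: "G' \<circ> (\<lambda>v. of_real (A x) * v + of_real s * \<beta> x * cnj v) = id"
      by (auto simp: fun_eq_iff)
    have right: "of_real (A x) * G' u + of_real s * \<beta> x * cnj (G' u) = u" for u
    proof -
      have "of_real (A x) * (of_real (A x) * u - of_real s * \<beta> x * cnj u)
          + of_real s * \<beta> x * cnj (of_real (A x) * u - of_real s * \<beta> x * cnj u) = of_real D * u"
        unfolding D' by (simp add: algebra_simps)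
      then show ?thesis unfolding G'_def using DA by (simp add: field_simps)
    qed
    have "(G has_derivative G') (at (F x))"
    proof (rule has_derivative_inverse_basic[OF _ linG' left _ open\<Omega>])
      show "(F has_derivative (\<lambda>v. of_real (A x) * v + of_real s * \<beta> x * cnj v)) (at (G (F x)))"
        using derF[OF x] GF[OF x] by simp
      show Fx: "F x \<in> \<Omega>" using x by (simp add: \<Omega>_def)
      show "continuous (at (F x)) G"
        using contG open\<Omega> Fx by (simp add: continuous_on_eq_continuous_at)
      show "F (G z) = z" if "z \<in> \<Omega>" for z using that by (auto simp: \<Omega>_def GF)
    qed
    then have "(f has_derivative
        (\<lambda>u. of_real c * cnj (\<beta> x) * G' u + of_real (c * \<tau> x - s) * cnj (G' u))) (at (F x))"
      unfolding f_def
      by (rule has_derivative_compose) (simp only: GF[OF x] derW[OF x])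
    moreover have "of_real c * cnj (\<beta> x) * G' u + of_real (c * \<tau> x - s) * cnj (G' u) = w x * u" for u
    proof -
      have "w x * (of_real s * \<beta> x) = of_real s * of_real c * (\<beta> x * cnj (\<beta> x)) / of_real (A x)"
        by (simp add: w_def)
      also have "\<dots> = of_real (s * c * (cmod (\<beta> x))\<^sup>2) / of_real (A x)"
        unfolding bb by simp
      also have "\<dots> = of_real (c * \<tau> x - s)"
        unfolding conf[OF x] using DA by simp
      finally have "w x * (of_real s * \<beta> x) = of_real (c * \<tau> x - s)" .
      moreover have "w x * of_real (A x) = of_real c * cnj (\<beta> x)"
        using DA by (simp add: w_def)
      ultimately have "of_real c * cnj (\<beta> x) * G' u + of_real (c * \<tau> x - s) * cnj (G' u)
          = w x * (of_real (A x) * G' u + of_real s * \<beta> x * cnj (G' u))"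
        by (simp only: distrib_left mult.assoc[symmetric])
      then show ?thesis by (simp only: right)
    qed
    ultimately show ?thesis
      by (simp add: has_field_derivative_def)
  qed
  have holf: "f holomorphic_on \<Omega>"
    unfolding holomorphic_on_open[OF open\<Omega>] using derf unfolding \<Omega>_def by blast
  have fF: "f (F x) = W x" if "x \<in> ball 0 R" for x by (simp add: f_def GF[OF that])
  have cs': "of_real c * of_real c + of_real s * of_real s = (1::complex)"
    using cs by (simp add: power2_eq_square flip: of_real_mult of_real_add)
  have XF: "of_real c * F x - of_real s * cnj (f (F x)) = x" if "x \<in> ball 0 R" for x
  proof -
    have "of_real c * F x - of_real s * cnj (f (F x))
        = (of_real c * of_real c + of_real s * of_real s) * x"
      unfolding fF[OF that] by (simp add: F_def W_def algebra_simps)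
    then show ?thesis by (simp add: cs')
  qed
  have PF: "of_real s * F x + of_real c * cnj (f (F x)) = P x" if "x \<in> ball 0 R" for x
  proof -
    have "of_real s * F x + of_real c * cnj (f (F x))
        = (of_real c * of_real c + of_real s * of_real s) * P x"
      unfolding fF[OF that] by (simp add: F_def W_def algebra_simps)
    then show ?thesis by (simp add: cs')
  qed
  have room: "ball (F x) (1 / (2 * c) * d) \<subseteq> \<Omega>" if "d > 0" "ball x d \<subseteq> ball 0 R" for x d
  proof -
    have "ball (F x) (1 / (2 * c) * d) \<subseteq> F ` ball x d"
      by (rule expanding_image_contains_ball[OF continuous_on_subset[OF contF that(2)] c2 that(1)
            expand[OF subsetD[OF that(2)] subsetD[OF that(2)]]])
    then show ?thesis using that(2) by (auto simp: \<Omega>_def)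
  qed
  have zero: "0 \<in> ball 0 R" using R by simp
  have m0: "m \<ge> 0" using m[OF zero] norm_ge_zero[of "P 0"] by linarith
  define y where "y = m / R"
  have y: "y \<ge> 0" using m0 R by (simp add: y_def)
  define \<phi> where "\<phi> = cmod (w 0)"
  have \<phi>: "\<phi> = c * cmod (\<beta> 0) / A 0"
    using c Apos[OF zero] by (simp add: \<phi>_def w_def norm_mult norm_divide)
  define \<epsilon> where "\<epsilon> = 1 - s / c * \<phi>"
  \<comment> \<open>For \<open>s = 0\<close> the equation is Laplace's equation and there is no degeneracy.\<close>
  have eps: "exp (- (32 * m / R)) / 6 \<le> \<epsilon>"
  proof (cases "s = 0")
    case True
    have "exp (- (32 * m / R)) \<le> 1" using m0 R by simp
    moreover have "\<epsilon> = 1" using True by (simp add: \<epsilon>_def)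
    ultimately show ?thesis by linarith
  next
    case False
    have "exp (- (32 * m / R)) / 6 \<le> 1 - s / c * cmod (deriv f (F 0))"
    proof (rule degeneracy_lower_bound[OF open\<Omega> holf c _ cs R])
      show "s * cmod (deriv f z) < c" if "z \<in> \<Omega>" for z
      proof -
        from that obtain x where x: "x \<in> ball 0 R" "z = F x" by (auto simp: \<Omega>_def)
        have "s * cmod (\<beta> x) < A x" using lower[OF x(1)] c2 by linarith
        then have "s * cmod (w x) < c"
          using c Apos[OF x(1)] by (simp add: w_def norm_mult norm_divide field_simps)
        then show ?thesis using DERIV_imp_deriv[OF derf[OF x(1)]] x(2) by simp
      qed
      show "ball z (R / (4 * c)) \<subseteq> \<Omega>"
        if "z \<in> \<Omega>" "cmod (of_real c * z - of_real s * cnj (f z)) \<le> R / 2" for z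
      proof -
        from that obtain x where x: "x \<in> ball 0 R" "z = F x" by (auto simp: \<Omega>_def)
        then have "cmod x \<le> R / 2" using that(2) XF by simp
        then have "ball x (R / 2) \<subseteq> ball 0 R"
          by (subst ball_subset_ball_iff) (simp add: dist_norm)
        then show ?thesis using room[of "R / 2" x] R x(2) by simp
      qed
      show "cmod (of_real s * z + of_real c * cnj (f z)) \<le> m" if "z \<in> \<Omega>" for z
        using that m PF by (auto simp: \<Omega>_def)
    qed (use False s XF[OF zero] zero in \<open>auto simp: \<Omega>_def\<close>)
    then show ?thesis
      using DERIV_imp_deriv[OF derf[OF zero]] by (simp add: \<epsilon>_def \<phi>_def)
  qed
  then have \<epsilon>: "\<epsilon> > 0" by (smt (verit) exp_gt_zero divide_pos_pos)
  have inv\<epsilon>: "1 / \<epsilon> \<le> 6 * exp (32 * y)"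
  proof -
    have "1 / \<epsilon> \<le> 1 / (exp (- (32 * y)) / 6)"
      using eps by (intro divide_left_mono) (auto simp: y_def \<epsilon>)
    then show ?thesis by (simp add: exp_minus field_simps)
  qed
  \<comment> \<open>For a phase near \<open>pi\<close>, where \<open>c\<close> is small, the expansion of \<open>F\<close> itself forces a large gradient.\<close>
  have invc: "1 / c \<le> 4 * (1 + y)"
  proof -
    let ?h = "complex_of_real (R / 2)"
    have h: "?h \<in> ball 0 R" "- ?h \<in> ball 0 R" using R by (auto simp: norm_divide)
    have "1 / (2 * c) * cmod (?h - - ?h) \<le> cmod (F ?h - F (- ?h))"
      by (rule expand) (use h in auto)
    also have "F ?h - F (- ?h) = of_real (c * R) + of_real s * (P ?h - P (- ?h))"
      by (simp add: F_def algebra_simps)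
    also have "cmod \<dots> \<le> c * R + s * cmod (P ?h - P (- ?h))"
      using norm_triangle_ineq[of "of_real (c * R) :: complex" "of_real s * (P ?h - P (- ?h))"] c s R
      by (simp add: norm_mult)
    also have "\<dots> \<le> 1 * R + 1 * (m + m)"
      using c1 s1 s R m[OF h(1)] m[OF h(2)] norm_triangle_ineq4[of "P ?h" "P (- ?h)"]
      by (intro add_mono mult_mono) auto
    finally have "R / (2 * c) \<le> R + 2 * m" using R by (simp add: norm_mult)
    then have "1 / (2 * c) \<le> 1 + 2 * y" using R c by (simp add: y_def field_simps)
    then show ?thesis using y c by (simp add: field_simps)
  qed
  \<comment> \<open>Cauchy's estimate bounds the rotated Hessian.\<close>
  have \<phi>4: "\<phi> \<le> 4 * (1 + y)"
  proof -
    have "R / 4 < 1 / (2 * c) * R"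
      using R c c1 by (simp add: field_simps)
    then have sub: "cball (F 0) (R / 4) \<subseteq> \<Omega>" using room[OF R, of 0] by auto
    have "norm ((deriv ^^ 1) f (F 0)) \<le> fact 1 * (R + m) / (R / 4) ^ 1"
    proof (rule Cauchy_inequality)
      show "f holomorphic_on ball (F 0) (R / 4)"
        using sub by (intro holomorphic_on_subset[OF holf]) auto
      show "continuous_on (cball (F 0) (R / 4)) f"
        using sub holf by (meson holomorphic_on_imp_continuous_on continuous_on_subset)
      show "norm (f u) \<le> R + m" if "norm (F 0 - u) = R / 4" for u
      proof -
        have "u \<in> \<Omega>" using sub that by (auto simp: dist_norm)
        then obtain x where x: "x \<in> ball 0 R" "u = F x" by (auto simp: \<Omega>_def)
        have "norm (f u) \<le> c * cmod (P x) + s * cmod x"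
          using norm_triangle_ineq4[of "of_real c * P x" "of_real s * x"] c s
          by (simp add: x(2) fF[OF x(1)] W_def norm_mult del: complex_cnj_diff complex_cnj_mult)
        also have "\<dots> \<le> 1 * m + 1 * R"
          using c1 s1 s m[OF x(1)] x(1) m0 by (intro add_mono mult_mono) auto
        finally show ?thesis by simp
      qed
    qed (use R in simp)
    then have "\<phi> \<le> (R + m) / (R / 4)"
      using DERIV_imp_deriv[OF derf[OF zero]] by (simp add: \<phi>_def)
    also have "\<dots> = 4 * (1 + y)" using R by (simp add: y_def field_simps)
    finally show ?thesis .
  qed
  \<comment> \<open>The larger eigenvalue recovered from the rotated one:
    \<open>tan (\<Theta> / 2 + arctan \<phi>) = (s + c * \<phi>) / (c - s * \<phi>)\<close>.\<close>
  have "(\<tau> 0 + cmod (\<beta> 0)) * (c * \<epsilon>) = s + c * \<phi>"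
  proof -
    let ?b = "cmod (\<beta> 0)"
    have Ae: "A 0 * \<epsilon> = A 0 - s * ?b"
      using c Apos[OF zero] by (simp add: \<epsilon>_def \<phi> field_simps)
    have "A 0 * ((\<tau> 0 + ?b) * (c * \<epsilon>)) = (\<tau> 0 + ?b) * c * (A 0 - s * ?b)"
      unfolding Ae[symmetric] by simp
    also have "\<dots> = c * \<tau> 0 * A 0 + c * ?b * (A 0 - s * \<tau> 0) - s * c * ?b\<^sup>2"
      by (simp add: algebra_simps power2_eq_square)
    also have "\<dots> = s * A 0 + c * ?b * (A 0 - s * \<tau> 0)"
      unfolding conf[OF zero] by (simp add: algebra_simps)
    also have "A 0 - s * \<tau> 0 = c" by (simp add: A_def)
    also have "s * A 0 + c * ?b * c = A 0 * (s + c * \<phi>)"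
      using Apos[OF zero] by (simp add: \<phi> field_simps)
    finally show ?thesis using Apos[OF zero] by simp
  qed
  then have "\<tau> 0 + cmod (\<beta> 0) = (s + c * \<phi>) * (1 / c) * (1 / \<epsilon>)"
    using c \<epsilon> by (simp add: field_simps)
  also have "\<dots> \<le> (1 + 1 * (4 * (1 + y))) * (4 * (1 + y)) * (6 * exp (32 * y))"
    using c s c1 s1 \<epsilon> y \<phi>4 invc inv\<epsilon>
    by (intro mult_mono add_mono) (auto simp: \<phi>_def)
  also have "\<dots> \<le> (5 * (1 + y)) * (4 * (1 + y)) * (6 * exp (32 * y))"
    using y by (intro mult_right_mono) auto
  also have "\<dots> = 120 * ((1 + y) * (1 + y) * exp (32 * y))" by (simp add: algebra_simps)
  also have "\<dots> \<le> 120 * (exp y * exp y * exp (32 * y))"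
    using y by (intro mult_left_mono mult_mono exp_ge_add_one_self) auto
  also have "\<dots> = 120 * exp (34 * m / R)"
    by (simp add: y_def flip: exp_add)
  finally have "\<tau> 0 + cmod (\<beta> 0) \<le> 120 * exp (34 * m / R)" .
  moreover have "\<tau> 0 \<ge> 0"
  proof -
    have "arctan (- (\<tau> 0 - cmod (\<beta> 0))) \<le> arctan (\<tau> 0 + cmod (\<beta> 0))"
      unfolding arctan_minus using phase[OF zero] \<Theta>(1) by linarith
    then show ?thesis by (simp only: arctan_le_iff)
  qed
  ultimately show ?thesis by simp
qed

section \<open>Symmetry of the Hessian\<close>

lemma second_difference_mean_value:
  fixes u :: "'a::real_normed_vector \<Rightarrow> real"
  assumes "t > 0"
    and S: "\<And>\<sigma> \<rho>. 0 \<le> \<sigma> \<Longrightarrow> \<sigma> \<le> t \<Longrightarrow> 0 \<le> \<rho> \<Longrightarrow> \<rho> \<le> t \<Longrightarrow> x + \<sigma> *\<^sub>R v + \<rho> *\<^sub>R w \<in> S"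
    and du: "\<And>y. y \<in> S \<Longrightarrow> (u has_derivative u' y) (at y)"
    and ddu: "\<And>y. y \<in> S \<Longrightarrow> ((\<lambda>z. u' z v) has_derivative u'' y) (at y)"
  obtains a b where "0 \<le> a" "a \<le> t" "0 \<le> b" "b \<le> t"
    and "u (x + t *\<^sub>R v + t *\<^sub>R w) - u (x + t *\<^sub>R v) - (u (x + t *\<^sub>R w) - u x)
      = t\<^sup>2 * u'' (x + a *\<^sub>R v + b *\<^sub>R w) w"
proof -
  have line: "((\<lambda>\<sigma>. f (y + \<sigma> *\<^sub>R k)) has_real_derivative f' k) (at \<sigma>)"
    if "(f has_derivative f') (at (y + \<sigma> *\<^sub>R k))" for f :: "'a \<Rightarrow> real" and f' y k \<sigma>
  proof -
    interpret f': bounded_linear f' using that by (rule has_derivative_bounded_linear)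
    have "((\<lambda>\<sigma>. y + \<sigma> *\<^sub>R k) has_derivative (\<lambda>h. h *\<^sub>R k)) (at \<sigma>)"
      by (auto intro!: derivative_eq_intros)
    from has_derivative_compose[OF this that] show ?thesis
      by (rule has_derivative_imp_has_field_derivative) (simp add: f'.scaleR)
  qed
  define \<phi> where "\<phi> \<sigma> = u (x + t *\<^sub>R w + \<sigma> *\<^sub>R v) - u (x + \<sigma> *\<^sub>R v)" for \<sigma>
  have "(\<phi> has_real_derivative u' (x + t *\<^sub>R w + \<sigma> *\<^sub>R v) v - u' (x + \<sigma> *\<^sub>R v) v) (at \<sigma>)"
    if "0 \<le> \<sigma>" "\<sigma> \<le> t" for \<sigma>
    unfolding \<phi>_def
    using S[OF that, of t] S[OF that, of 0] \<open>t > 0\<close>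
    by (intro DERIV_diff line du) (auto simp: algebra_simps)
  then obtain a where a: "0 < a" "a < t"
    and eq1: "\<phi> t - \<phi> 0 = (t - 0) * (u' (x + t *\<^sub>R w + a *\<^sub>R v) v - u' (x + a *\<^sub>R v) v)"
    using MVT2[of 0 t \<phi> "\<lambda>\<sigma>. u' (x + t *\<^sub>R w + \<sigma> *\<^sub>R v) v - u' (x + \<sigma> *\<^sub>R v) v"] \<open>t > 0\<close>
    by blast
  have "((\<lambda>\<rho>. u' (x + a *\<^sub>R v + \<rho> *\<^sub>R w) v) has_real_derivative u'' (x + a *\<^sub>R v + \<rho> *\<^sub>R w) w) (at \<rho>)"
    if "0 \<le> \<rho>" "\<rho> \<le> t" for \<rho>
    by (rule line[of "\<lambda>z. u' z v"], rule ddu, rule S) (use a that in auto)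
  then obtain b where b: "0 < b" "b < t"
    and eq2: "u' (x + a *\<^sub>R v + t *\<^sub>R w) v - u' (x + a *\<^sub>R v + 0 *\<^sub>R w) v
      = (t - 0) * u'' (x + a *\<^sub>R v + b *\<^sub>R w) w"
    using MVT2[of 0 t "\<lambda>\<rho>. u' (x + a *\<^sub>R v + \<rho> *\<^sub>R w) v" "\<lambda>\<rho>. u'' (x + a *\<^sub>R v + \<rho> *\<^sub>R w) w"] \<open>t > 0\<close>
    by blast
  have "u (x + t *\<^sub>R v + t *\<^sub>R w) - u (x + t *\<^sub>R v) - (u (x + t *\<^sub>R w) - u x) = \<phi> t - \<phi> 0"
    by (simp add: \<phi>_def add_ac)
  also have "\<dots> = t * (u' (x + a *\<^sub>R v + t *\<^sub>R w) v - u' (x + a *\<^sub>R v + 0 *\<^sub>R w) v)"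
    using eq1 by (simp add: add_ac)
  also have "\<dots> = t\<^sup>2 * u'' (x + a *\<^sub>R v + b *\<^sub>R w) w"
    unfolding eq2 by (simp add: power2_eq_square)
  finally show ?thesis using a b by (intro that[of a b]) auto
qed

text \<open>
  The second difference with steps \<open>t v\<close> and \<open>t w\<close> is symmetric in \<open>v\<close> and \<open>w\<close>, and \<open>t\<^sup>2\<close> times a nearby
  value of either mixed derivative.
\<close>

lemma second_derivative_symmetric:
  fixes u :: "'a::real_normed_vector \<Rightarrow> real"
  assumes "open S" "x \<in> S"
    and du: "\<And>y. y \<in> S \<Longrightarrow> (u has_derivative u' y) (at y)"
    and ddu: "\<And>y v. y \<in> S \<Longrightarrow> ((\<lambda>z. u' z v) has_derivative u'' v y) (at y)"
    and cont: "\<And>v w. continuous_on S (\<lambda>y. u'' v y w)"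
  shows "u'' v x w = u'' w x v"
proof (rule ccontr)
  assume ne: "u'' v x w \<noteq> u'' w x v"
  define e where "e = dist (u'' v x w) (u'' w x v) / 2"
  have "e > 0" using ne by (simp add: e_def)
  obtain d0 where d0: "d0 > 0" "ball x d0 \<subseteq> S"
    using \<open>open S\<close> \<open>x \<in> S\<close> open_contains_ball by blast
  have "\<exists>d>0. \<forall>y\<in>S. dist y x < d \<longrightarrow> dist (u'' v y w) (u'' v x w) < e" for v w
    using cont[of v w] \<open>x \<in> S\<close> \<open>e > 0\<close> unfolding continuous_on_iff by blast
  then obtain d1 d2 where d1: "d1 > 0" "\<And>y. y \<in> S \<Longrightarrow> dist y x < d1 \<Longrightarrow> dist (u'' v y w) (u'' v x w) < e"
    and d2: "d2 > 0" "\<And>y. y \<in> S \<Longrightarrow> dist y x < d2 \<Longrightarrow> dist (u'' w y v) (u'' w x v) < e"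
    by metis
  define d where "d = min d0 (min d1 d2)"
  define t where "t = d / (2 * (norm v + norm w + 1))"
  have pos: "norm v + norm w + 1 > 0"
    by (intro add_nonneg_pos add_nonneg_nonneg) auto
  have half_scale: "d / (2 * k) * k = d / 2" if "k > 0" for k :: real
    using that by simp
  have d: "d > 0" using d0 d1 d2 by (simp add: d_def)
  then have t: "t > 0" using pos by (simp add: t_def)
  have close: "dist (x + \<sigma> *\<^sub>R v + \<rho> *\<^sub>R w) x < d"
    if "0 \<le> \<sigma>" "\<sigma> \<le> t" "0 \<le> \<rho>" "\<rho> \<le> t" for \<sigma> \<rho>
  proof -
    have "dist (x + \<sigma> *\<^sub>R v + \<rho> *\<^sub>R w) x = norm (\<sigma> *\<^sub>R v + \<rho> *\<^sub>R w)"
      by (simp add: dist_norm add.assoc)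
    also have "\<dots> \<le> \<sigma> * norm v + \<rho> * norm w"
      using norm_triangle_ineq[of "\<sigma> *\<^sub>R v" "\<rho> *\<^sub>R w"] that by simp
    also have "\<dots> \<le> t * norm v + t * norm w"
      using that by (intro add_mono mult_right_mono) auto
    also have "\<dots> \<le> t * (norm v + norm w + 1)" using t by (simp add: algebra_simps)
    also have "\<dots> = d / 2" unfolding t_def using pos by (intro half_scale)
    finally show ?thesis using d by simp
  qed
  have inS: "y \<in> S" if "dist y x < d" for y
    using that d0 by (auto simp: d_def dist_commute)
  obtain a b where ab: "0 \<le> a" "a \<le> t" "0 \<le> b" "b \<le> t"
    and eq1: "u (x + t *\<^sub>R v + t *\<^sub>R w) - u (x + t *\<^sub>R v) - (u (x + t *\<^sub>R w) - u x)
      = t\<^sup>2 * u'' v (x + a *\<^sub>R v + b *\<^sub>R w) w"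
    by (rule second_difference_mean_value[OF t inS[OF close] du ddu])
  have close': "dist (x + \<sigma> *\<^sub>R w + \<rho> *\<^sub>R v) x < d"
    if "0 \<le> \<sigma>" "\<sigma> \<le> t" "0 \<le> \<rho>" "\<rho> \<le> t" for \<sigma> \<rho>
    using close[of \<rho> \<sigma>] that by (simp add: add_ac)
  obtain a' b' where ab': "0 \<le> a'" "a' \<le> t" "0 \<le> b'" "b' \<le> t"
    and eq2: "u (x + t *\<^sub>R w + t *\<^sub>R v) - u (x + t *\<^sub>R w) - (u (x + t *\<^sub>R v) - u x)
      = t\<^sup>2 * u'' w (x + a' *\<^sub>R w + b' *\<^sub>R v) v"
    by (rule second_difference_mean_value[OF t inS[OF close'] du ddu])
  have "t\<^sup>2 * u'' v (x + a *\<^sub>R v + b *\<^sub>R w) w = t\<^sup>2 * u'' w (x + a' *\<^sub>R w + b' *\<^sub>R v) v"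
    unfolding eq1[symmetric] eq2[symmetric] by (simp add: add_ac)
  then have "u'' v (x + a *\<^sub>R v + b *\<^sub>R w) w = u'' w (x + a' *\<^sub>R w + b' *\<^sub>R v) v"
    using t by simp
  moreover have "dist (u'' v (x + a *\<^sub>R v + b *\<^sub>R w) w) (u'' v x w) < e"
    using d1(2) inS close[OF ab] by (simp add: d_def)
  moreover have "dist (u'' w (x + a' *\<^sub>R w + b' *\<^sub>R v) v) (u'' w x v) < e"
    using d2(2) inS close'[OF ab'] by (simp add: d_def)
  ultimately show False
    using dist_triangle3[of "u'' v x w" "u'' w x v" "u'' v (x + a *\<^sub>R v + b *\<^sub>R w) w"]
    by (simp add: e_def)
qed

lemma smooth_on_hessian:
  fixes u :: "real ^ 'n \<Rightarrow> real"
  assumes S: "open S" "x \<in> S" and u: "smooth_on S u"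
  shows "(grad u has_derivative (\<lambda>h. hessian u x *v h)) (at x)"
    and "transpose (hessian u x) = hessian u x"
proof -
  define D1 where "D1 y v = frechet_derivative u (at y) v" for y v
  define D2 where "D2 v y w = frechet_derivative (\<lambda>z. D1 z v) (at y) w" for v y w
  have "Ck_on (Suc (Suc 0)) S u" using u by (simp add: smooth_on_def)
  then have *: "\<And>y. y \<in> S \<Longrightarrow> u differentiable (at y)"
    "\<And>v y. y \<in> S \<Longrightarrow> (\<lambda>z. D1 z v) differentiable (at y)"
    "\<And>v w. continuous_on S (\<lambda>y. D2 v y w)"
    by (auto simp: D1_def D2_def)
  have du: "(u has_derivative D1 y) (at y)" if "y \<in> S" for y
    using *(1)[OF that] by (simp add: D1_def[abs_def] frechet_derivative_works)
  have ddu: "((\<lambda>z. D1 z v) has_derivative D2 v y) (at y)" if "y \<in> S" for y v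
    using *(2)[OF that, of v] by (simp add: D2_def[abs_def] frechet_derivative_works)
  have "(grad u has_derivative (\<lambda>h. \<chi> i. D2 (axis i 1) x h)) (at x)"
  proof (rule has_derivative_componentwise_within[THEN iffD2], rule ballI)
    fix b :: "real ^ 'n"
    assume "b \<in> Basis"
    then obtain i where b: "b = axis i 1" by (auto simp: Basis_vec_def)
    have "(\<lambda>z. grad u z \<bullet> b) = (\<lambda>z. D1 z (axis i 1))"
      by (simp add: b inner_axis grad_def D1_def)
    moreover have "(\<lambda>h. (\<chi> i. D2 (axis i 1) x h) \<bullet> b) = D2 (axis i 1) x"
      by (simp add: b inner_axis)
    ultimately show "((\<lambda>z. grad u z \<bullet> b) has_derivative (\<lambda>h. (\<chi> i. D2 (axis i 1) x h) \<bullet> b)) (at x)"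
      using ddu[OF S(2)] by simp
  qed
  then have gd: "grad u differentiable (at x)" and
    fd: "frechet_derivative (grad u) (at x) = (\<lambda>h. \<chi> i. D2 (axis i 1) x h)"
    by (rule differentiableI, rule frechet_derivative_at[symmetric])
  show "(grad u has_derivative (\<lambda>h. hessian u x *v h)) (at x)"
    using gd unfolding hessian_def jacobian_works .
  have "hessian u x $ i $ j = D2 (axis i 1) x (axis j 1)" for i j
    by (simp add: hessian_def jacobian_def fd matrix_def)
  moreover have "D2 v x w = D2 w x v" for v w
    by (rule second_derivative_symmetric[OF S du ddu *(3)])
  ultimately show "transpose (hessian u x) = hessian u x"
    by (simp add: transpose_def vec_eq_iff)
qed

section \<open>Symmetric two-by-two matrices as real-linear maps of the complex plane\<close>

text \<open>The isometric identification of the Euclidean plane with the complex numbers, and its inverse.\<close>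

definition vec2_to_complex :: "real ^ 2 \<Rightarrow> complex"
  where "vec2_to_complex v = Complex (v $ 1) (v $ 2)"

definition complex_to_vec2 :: "complex \<Rightarrow> real ^ 2"
  where "complex_to_vec2 z = vector [Re z, Im z]"

lemma vec2_to_complex_inverse [simp]: "complex_to_vec2 (vec2_to_complex v) = v"
  by (simp add: vec2_to_complex_def complex_to_vec2_def vec_eq_iff forall_2)

lemma complex_to_vec2_inverse [simp]: "vec2_to_complex (complex_to_vec2 z) = z"
  by (simp add: vec2_to_complex_def complex_to_vec2_def)

lemma cmod_vec2_to_complex [simp]: "cmod (vec2_to_complex v) = norm v"
  by (simp add: vec2_to_complex_def norm_vec_def L2_set_def UNIV_2 cmod_def)

lemma norm_complex_to_vec2 [simp]: "norm (complex_to_vec2 z) = cmod z"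
  by (metis cmod_vec2_to_complex complex_to_vec2_inverse)

lemma bounded_linear_vec2_to_complex: "bounded_linear vec2_to_complex"
  unfolding linear_conv_bounded_linear[symmetric]
  by (intro linearI) (simp_all add: vec2_to_complex_def complex_eq_iff)

lemma bounded_linear_complex_to_vec2: "bounded_linear complex_to_vec2"
  unfolding linear_conv_bounded_linear[symmetric]
  by (intro linearI) (simp_all add: complex_to_vec2_def vec_eq_iff forall_2)

text \<open>
  A symmetric matrix acts on the complex plane as \<open>v \<mapsto> \<tau> v + \<beta> cnj v\<close>, where \<open>\<tau>\<close> is half the trace
  and \<open>\<beta>\<close> encodes the trace-free part. Only the upper triangle of the matrix is read.
\<close>

definition half_trace :: "real ^ 2 ^ 2 \<Rightarrow> real"
  where "half_trace A = (A $ 1 $ 1 + A $ 2 $ 2) / 2"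

definition traceless_part :: "real ^ 2 ^ 2 \<Rightarrow> complex"
  where "traceless_part A = Complex ((A $ 1 $ 1 - A $ 2 $ 2) / 2) (A $ 1 $ 2)"

lemma symmetric_matrix_complex_form:
  assumes "transpose A = A"
  shows "vec2_to_complex (A *v v)
    = of_real (half_trace A) * vec2_to_complex v + traceless_part A * cnj (vec2_to_complex v)"
proof -
  have "A $ 2 $ 1 = transpose A $ 1 $ 2"
    by (simp add: transpose_def)
  then have "A $ 2 $ 1 = A $ 1 $ 2"
    by (simp only: assms)
  then show ?thesis
    by (simp add: vec2_to_complex_def half_trace_def traceless_part_def complex_eq_iff
        matrix_vector_mult_def sum_2 field_simps)
qed

lemma eigenvalues2_half_trace:
  assumes sym: "transpose A = A" and ev: "eigenvalues2 A l1 l2"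
  shows "half_trace A = (l1 + l2) / 2" and "cmod (traceless_part A) = \<bar>l1 - l2\<bar> / 2"
proof -
  have "A $ 2 $ 1 = transpose A $ 1 $ 2"
    by (simp add: transpose_def)
  then have A21: "A $ 2 $ 1 = A $ 1 $ 2"
    by (simp only: sym)
  have char_poly: "(t - A $ 1 $ 1) * (t - A $ 2 $ 2) - A $ 1 $ 2 * A $ 1 $ 2 = (t - l1) * (t - l2)" for t
    using ev by (simp add: eigenvalues2_def det_2 mat_def A21)
  have det: "A $ 1 $ 1 * A $ 2 $ 2 - A $ 1 $ 2 * A $ 1 $ 2 = l1 * l2"
    using char_poly[of 0] by simp
  have tr: "A $ 1 $ 1 + A $ 2 $ 2 = l1 + l2"
    using char_poly[of 1] det by (simp add: algebra_simps)
  show "half_trace A = (l1 + l2) / 2" by (simp add: half_trace_def tr)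
  have "(cmod (traceless_part A))\<^sup>2
      = ((A $ 1 $ 1 + A $ 2 $ 2)\<^sup>2 - 4 * (A $ 1 $ 1 * A $ 2 $ 2 - A $ 1 $ 2 * A $ 1 $ 2)) / 4"
    unfolding cmod_power2 by (simp add: traceless_part_def power2_eq_square field_simps)
  also have "\<dots> = (\<bar>l1 - l2\<bar> / 2)\<^sup>2"
    unfolding tr det by (simp add: power_divide power2_eq_square algebra_simps)
  finally show "cmod (traceless_part A) = \<bar>l1 - l2\<bar> / 2"
    by (rule power2_eq_imp_eq) auto
qed

lemma op_norm_le:
  assumes "transpose A = A"
  shows "op_norm A \<le> \<bar>half_trace A\<bar> + cmod (traceless_part A)"
  unfolding op_norm_def
proof (rule onorm_le)
  fix v
  have "norm (A *v v) = cmod (vec2_to_complex (A *v v))" by simp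
  also have "\<dots> \<le> cmod (of_real (half_trace A) * vec2_to_complex v)
      + cmod (traceless_part A * cnj (vec2_to_complex v))"
    unfolding symmetric_matrix_complex_form[OF assms] by (rule norm_triangle_ineq)
  also have "\<dots> = (\<bar>half_trace A\<bar> + cmod (traceless_part A)) * norm v"
    by (simp add: norm_mult algebra_simps)
  finally show "norm (A *v v) \<le> (\<bar>half_trace A\<bar> + cmod (traceless_part A)) * norm v" .
qed

section \<open>The Hessian estimates\<close>

text \<open>
  A bound with exponent linear in the gradient and constants uniform in the phase. A negative phase
  is reduced to a positive one by changing the sign of \<open>u\<close>.
\<close>

lemma hessian_bound_linear_exponent:
  fixes u :: "real ^ 2 \<Rightarrow> real"
  assumes R: "R > 0" and u: "smooth_on (ball 0 R) u"
    and sl: "special_lagrangian_on (ball 0 R) \<Theta> u"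
    and m: "\<And>x. x \<in> ball 0 R \<Longrightarrow> norm (grad u x) \<le> m"
  shows "op_norm (hessian u 0) \<le> 120 * exp (34 * m / R)"
proof -
  define P where "P z = vec2_to_complex (grad u (complex_to_vec2 z))" for z
  define \<tau> where "\<tau> z = half_trace (hessian u (complex_to_vec2 z))" for z
  define \<beta> where "\<beta> z = traceless_part (hessian u (complex_to_vec2 z))" for z
  have in_ball: "complex_to_vec2 z \<in> ball 0 R" if "z \<in> ball 0 R" for z
    using that by (simp add: dist_norm)
  have sym: "transpose (hessian u x) = hessian u x" if "x \<in> ball 0 R" for x
    by (rule smooth_on_hessian(2)[OF open_ball that u])
  have der: "(P has_derivative (\<lambda>v. of_real (\<tau> z) * v + \<beta> z * cnj v)) (at z)"
    if z: "z \<in> ball 0 R" for z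
  proof -
    have "(P has_derivative
        (\<lambda>v. vec2_to_complex (hessian u (complex_to_vec2 z) *v complex_to_vec2 v))) (at z)"
      unfolding P_def
      by (intro bounded_linear.has_derivative[OF bounded_linear_vec2_to_complex]
          has_derivative_compose[OF bounded_linear_imp_has_derivative[OF bounded_linear_complex_to_vec2]]
          smooth_on_hessian(1)[OF open_ball in_ball[OF z] u])
    then show ?thesis
      by (simp add: symmetric_matrix_complex_form[OF sym[OF in_ball[OF z]]] \<tau>_def \<beta>_def)
  qed
  have phase: "arctan (\<tau> z + cmod (\<beta> z)) + arctan (\<tau> z - cmod (\<beta> z)) = \<Theta>"
    if z: "z \<in> ball 0 R" for z
  proof -
    obtain l1 l2 where l: "eigenvalues2 (hessian u (complex_to_vec2 z)) l1 l2"
      "arctan l1 + arctan l2 = \<Theta>"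
      using sl in_ball[OF z] unfolding special_lagrangian_on_def by blast
    note ht = eigenvalues2_half_trace[OF sym[OF in_ball[OF z]] l(1), folded \<tau>_def \<beta>_def]
    have "(\<tau> z + cmod (\<beta> z) = l1 \<and> \<tau> z - cmod (\<beta> z) = l2)
        \<or> (\<tau> z + cmod (\<beta> z) = l2 \<and> \<tau> z - cmod (\<beta> z) = l1)"
      unfolding ht by (cases "l1 \<ge> l2") (auto simp: field_simps)
    then show ?thesis using l(2) by auto
  qed
  have bound: "cmod (P z) \<le> m" if "z \<in> ball 0 R" for z
    using m[OF in_ball[OF that]] by (simp add: P_def)
  have zero: "0 \<in> ball 0 R" using R by simp
  have \<Theta>: "- pi < \<Theta>" "\<Theta> < pi"
    using phase[OF zero] arctan_bounded[of "\<tau> 0 + cmod (\<beta> 0)"] arctan_bounded[of "\<tau> 0 - cmod (\<beta> 0)"]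
    by linarith+
  have "\<bar>\<tau> 0\<bar> + cmod (\<beta> 0) \<le> 120 * exp (34 * m / R)"
  proof (cases "\<Theta> \<ge> 0")
    case True
    then show ?thesis
      using \<Theta> by (intro hessian_bound_complex[OF R _ _ der phase bound]) auto
  next
    case False
    have "\<bar>- \<tau> 0\<bar> + cmod (- \<beta> 0) \<le> 120 * exp (34 * m / R)"
    proof (rule hessian_bound_complex[of R "- \<Theta>" "\<lambda>z. - P z"])
      show "((\<lambda>z. - P z) has_derivative (\<lambda>v. of_real (- \<tau> z) * v + - \<beta> z * cnj v)) (at z)"
        if "z \<in> ball 0 R" for z
        using has_derivative_minus[OF der[OF that]] by simp
      show "arctan (- \<tau> z + cmod (- \<beta> z)) + arctan (- \<tau> z - cmod (- \<beta> z)) = - \<Theta>"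
        if "z \<in> ball 0 R" for z
        using phase[OF that] arctan_minus[of "\<tau> z + cmod (\<beta> z)"] arctan_minus[of "\<tau> z - cmod (\<beta> z)"]
        by simp
    qed (use R False \<Theta> bound in auto)
    then show ?thesis by simp
  qed
  moreover have "complex_to_vec2 0 = 0"
    by (metis norm_complex_to_vec2 norm_eq_zero norm_zero)
  ultimately show ?thesis
    using op_norm_le[OF sym[of 0]] R by (simp add: \<tau>_def \<beta>_def)
qed

theorem theorem1p1:
  shows "\<exists>C>0. \<forall>(R::real) (\<Theta>::real) (u :: real ^ 2 \<Rightarrow> real).
           R > 0 \<longrightarrow> smooth_on (ball 0 R) u \<longrightarrow> special_lagrangian_on (ball 0 R) \<Theta> u \<longrightarrow>
           bdd_above ((\<lambda>x. norm (grad u x)) ` ball 0 R) \<longrightarrow>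
             op_norm (hessian u 0) \<le> C * exp (C * (SUP x\<in>ball 0 R. (norm (grad u x))\<^sup>2) / R\<^sup>2) \<and>
             (sin \<Theta> \<noteq> 0 \<longrightarrow>
               op_norm (hessian u 0) \<le>
                 C * exp (C * (1 / \<bar>sin \<Theta>\<bar> powr (3 / 2)) * (SUP x\<in>ball 0 R. norm (grad u x)) / R))"
proof (intro exI[of _ "120 * exp 34"] conjI allI impI)
  fix R \<Theta> :: real and u :: "real ^ 2 \<Rightarrow> real"
  assume R: "R > 0" and u: "smooth_on (ball 0 R) u" and sl: "special_lagrangian_on (ball 0 R) \<Theta> u"
    and bdd: "bdd_above ((\<lambda>x. norm (grad u x)) ` ball 0 R)"
  define C :: real where "C = 120 * exp 34"
  have "exp 34 \<ge> (1::real)" by simp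
  then have C: "C \<ge> 120" "C \<ge> 34" unfolding C_def by linarith+
  define m where "m = (SUP x\<in>ball 0 R. norm (grad u x))"
  define M where "M = (SUP x\<in>ball 0 R. (norm (grad u x))\<^sup>2)"
  have m: "norm (grad u x) \<le> m" if "x \<in> ball 0 R" for x
    unfolding m_def by (rule cSUP_upper[OF that bdd])
  have "bdd_above ((\<lambda>x. (norm (grad u x))\<^sup>2) ` ball 0 R)"
    by (intro bdd_aboveI2[of _ _ "m\<^sup>2"] power_mono m) auto
  then have M: "(norm (grad u x))\<^sup>2 \<le> M" if "x \<in> ball 0 R" for x
    unfolding M_def using that by (rule cSUP_upper[rotated])
  have zero: "0 \<in> ball 0 R" using R by simp
  have m0: "m \<ge> 0" using m[OF zero] norm_ge_zero[of "grad u 0"] by linarith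
  have M0: "M \<ge> 0" using M[OF zero] zero_le_power2[of "norm (grad u 0)"] by linarith
  show "op_norm (hessian u 0) \<le> C * exp (C * M / R\<^sup>2)"
  proof -
    let ?y = "sqrt M / R"
    have "op_norm (hessian u 0) \<le> 120 * exp (34 * sqrt M / R)"
      by (rule hessian_bound_linear_exponent[OF R u sl]) (simp add: M real_le_rsqrt)
    also have "34 * sqrt M / R \<le> 34 + C * M / R\<^sup>2"
    proof -
      \<comment> \<open>The additive constant is absorbed by the factor \<open>exp 34\<close> in \<open>C\<close>.\<close>
      have "?y \<le> 1 + ?y\<^sup>2"
        using zero_le_power2[of "?y - 1/2"] by (simp add: power2_eq_square algebra_simps)
      also have "?y\<^sup>2 = M / R\<^sup>2" using M0 by (simp add: power_divide)
      finally have "34 * sqrt M / R \<le> 34 + 34 * (M / R\<^sup>2)" by simp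
      also have "\<dots> \<le> 34 + C * (M / R\<^sup>2)"
        using C M0 by (intro add_left_mono mult_right_mono) auto
      finally show ?thesis by simp
    qed
    finally show ?thesis by (simp add: C_def exp_add)
  qed
  assume sin: "sin \<Theta> \<noteq> 0"
  show "op_norm (hessian u 0) \<le> C * exp (C * (1 / \<bar>sin \<Theta>\<bar> powr (3 / 2)) * m / R)"
  proof -
    have "\<bar>sin \<Theta>\<bar> powr (3 / 2) \<le> 1"
      using powr_mono2[of "3/2" "\<bar>sin \<Theta>\<bar>" 1] by simp
    then have "1 \<le> 1 / \<bar>sin \<Theta>\<bar> powr (3 / 2)"
      using sin by simp
    then have "34 * 1 * (m / R) \<le> C * (1 / \<bar>sin \<Theta>\<bar> powr (3 / 2)) * (m / R)"
      using C m0 R by (intro mult_right_mono mult_mono) auto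
    then have "exp (34 * m / R) \<le> exp (C * (1 / \<bar>sin \<Theta>\<bar> powr (3 / 2)) * m / R)"
      by (simp only: exp_le_cancel_iff times_divide_eq_right mult_1_right)
    with C(1) have "120 * exp (34 * m / R) \<le> C * exp (C * (1 / \<bar>sin \<Theta>\<bar> powr (3 / 2)) * m / R)"
      by (rule mult_mono) (use C in auto)
    with hessian_bound_linear_exponent[OF R u sl m] show ?thesis by (rule order_trans)
  qed
qed auto

end
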